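(* For every integer $k\geq 1$, $$\gamma(P(4k,k))=\begin{cases} 2k, & \text{if } k\equiv 1 \pmod 2;\\ 2k+1, & \text{if } k\equiv 0 \pmod 2.\end{cases}$$
   Context: The generalized Petersen graph $P(n,k)$ is the graph on $2n$ vertices with vertex set $\{v_i,u_i: 0\leq i\leq n-1\}$ and edge set $\{v_iv_{i+1},\ v_iu_i,\ u_iu_{i+k}: 0\leq i\leq n-1\}$, subscripts taken modulo $n$. For a graph $G$, a set $S\subseteq V(G)$ is a dominating set if every vertex of $G$ is in $S$ or adjacent to some vertex of $S$; the domination number $\gamma(G)$ is the minimum cardinality of a dominating set of $G$. *)

theory Defs
  imports Main
begin

text \<open>An undirected graph is a pair of its vertex set and its edge set, an edge being the
  set of its two end vertices.\<close>

type_synonym 'a graph = "'a set \<times> 'a set set"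

abbreviation verts :: "'a graph \<Rightarrow> 'a set" where
  "verts G \<equiv> fst G"

abbreviation edges :: "'a graph \<Rightarrow> 'a set set" where
  "edges G \<equiv> snd G"

definition dominating_set :: "'a graph \<Rightarrow> 'a set \<Rightarrow> bool" where
  "dominating_set G S \<longleftrightarrow>
     S \<subseteq> verts G \<and> (\<forall>x \<in> verts G. x \<in> S \<or> (\<exists>y \<in> S. {x, y} \<in> edges G))"

text \<open>The finiteness condition is automatic for finite graphs; it only excludes infinite
  sets, to which \<^const>\<open>card\<close> assigns 0.\<close>

definition domination_number :: "'a graph \<Rightarrow> nat" where
  "domination_number G = (LEAST m. \<exists>S. dominating_set G S \<and> finite S \<and> card S = m)"

datatype gp_vertex = V nat | U nat

definition gen_petersen :: "nat \<Rightarrow> nat \<Rightarrow> gp_vertex graph" where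
  "gen_petersen n k =
     ({V i | i. i < n} \<union> {U i | i. i < n},
      {{V i, V ((i + 1) mod n)} | i. i < n} \<union>
      {{V i, U i} | i. i < n} \<union>
      {{U i, U ((i + k) mod n)} | i. i < n})"

end

theory Submission
  imports Defs
begin

text \<open>
  Every vertex has degree 3, so a vertex dominates at most 4 of the \<open>8k\<close> vertices and at least
  \<open>2k\<close> vertices are needed. For odd \<open>k\<close> this is attained by the outer vertices with index
  \<open>0 mod 4\<close> and the inner vertices with index \<open>2 mod 4\<close>; the inner edges join indices of opposite
  parity, which is what makes this set dominate.

  For the remaining parts, write an index as \<open>c + j k\<close> with a column \<open>0 \<le> c < k\<close> and a row
  \<open>j\<close> modulo 4. The inner vertices of a column form a 4-cycle, and a step along the outer cycle
  moves one column to the right within a row, except that the last column is followed by the first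
  column one row further.

  If \<open>2k\<close> vertices dominate, no vertex is dominated twice, and counting the outer and the inner
  vertices separately gives \<open>k\<close> chosen vertices of either kind. Two chosen inner vertices of one
  column would dominate a common vertex, so every column has at most one of them; the inner vertex
  opposite to it can then only be dominated by its outer partner. By counting, the chosen outer
  vertices are exactly these partners, one in each column. Consecutive columns have them in
  adjacent rows (\<open>perfect_pattern_odd\<close>): the outer vertices in the two rows next to the chosen
  one have to be dominated from the left or from the right, and one neighbouring column cannot
  serve both. Hence the parity of the row changes with every step to the right. After \<open>k\<close> steps
  the same column is reached again with its rows renumbered by 1, so \<open>k\<close> is odd.

  For even \<open>k\<close> the staircase shape of this pattern still dominates everything but at most two outer
  vertices at the seam between the last and the first column. The direction of the staircase can
  be chosen so that one extra vertex repairs both defects.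
\<close>

section \<open>Vertices and neighbours indexed by integers\<close>

text \<open>Integer indices, read modulo \<open>n\<close>, make the subtraction in \<open>x - 1\<close> and \<open>x - k\<close>
  total and turn membership in a vertex set into a periodic predicate.\<close>

definition outer :: "nat \<Rightarrow> int \<Rightarrow> gp_vertex" where
  "outer n x = V (nat (x mod int n))"

definition inner :: "nat \<Rightarrow> int \<Rightarrow> gp_vertex" where
  "inner n x = U (nat (x mod int n))"

lemma outer_neq_inner [simp]: "outer n x \<noteq> inner n y" "inner n y \<noteq> outer n x"
  by (simp_all add: outer_def inner_def)

lemma outer_eq_iff: "n > 0 \<Longrightarrow> outer n x = outer n y \<longleftrightarrow> x mod int n = y mod int n"
  by (simp add: outer_def nat_eq_iff)

lemma inner_eq_iff: "n > 0 \<Longrightarrow> inner n x = inner n y \<longleftrightarrow> x mod int n = y mod int n"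
  by (simp add: inner_def nat_eq_iff)

lemma nat_mod_add:
  assumes "n > 0"
  shows "nat ((x + int c) mod int n) = (nat (x mod int n) + c) mod n"
proof -
  have "int ((nat (x mod int n) + c) mod n) = (x mod int n + int c) mod int n"
    using assms by (simp add: zmod_int)
  also have "\<dots> = (x + int c) mod int n" by (rule mod_add_left_eq)
  finally show ?thesis by (metis nat_int)
qed

lemma verts_gen_petersen:
  assumes "n > 0"
  shows "verts (gen_petersen n k) = range (outer n) \<union> range (inner n)"
proof -
  have "{i. i < n} = range (\<lambda>x. nat (x mod int n))"
  proof (intro equalityI subsetI)
    fix i assume "i \<in> {i. i < n}"
    then have "i = nat (int i mod int n)" by simp
    then show "i \<in> range (\<lambda>x. nat (x mod int n))" by blast
  qed (use assms in \<open>auto simp: nat_less_iff\<close>)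
  then have "V ` {i. i < n} = range (outer n)" "U ` {i. i < n} = range (inner n)"
    unfolding outer_def[abs_def] inner_def[abs_def] by (simp_all only: image_image)
  then show ?thesis unfolding gen_petersen_def fst_conv by blast
qed

lemma edges_gen_petersen:
  assumes "n > 0"
  shows "edges (gen_petersen n k) =
    range (\<lambda>x. {outer n x, outer n (x + 1)}) \<union> range (\<lambda>x. {outer n x, inner n x}) \<union>
    range (\<lambda>x. {inner n x, inner n (x + int k)})"
proof -
  have index: "{f i | i. i < n} = range (\<lambda>x. f (nat (x mod int n)))"
    for f :: "nat \<Rightarrow> gp_vertex set"
  proof (intro equalityI subsetI)
    fix e assume "e \<in> {f i | i. i < n}"
    then obtain i where "i < n" "e = f i" by blast
    then have "e = f (nat (int i mod int n))" by simp
    then show "e \<in> range (\<lambda>x. f (nat (x mod int n)))" by blast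
  next
    fix e assume "e \<in> range (\<lambda>x. f (nat (x mod int n)))"
    moreover have "nat (x mod int n) < n" for x using assms by (simp add: nat_less_iff)
    ultimately show "e \<in> {f i | i. i < n}" by blast
  qed
  show ?thesis
    unfolding gen_petersen_def outer_def inner_def snd_conv index
    by (simp only: nat_mod_add[OF assms] nat_mod_add[OF assms, of _ 1, simplified of_nat_1])
qed

lemma mod_shift_cancel: "(x + c) mod m = (y + c) mod m \<longleftrightarrow> x mod m = y mod m" for x :: int
  unfolding mod_eq_dvd_iff by simp

lemma vertex_shift_cong:
  assumes "n > 0"
  shows "outer n x = outer n z \<Longrightarrow> outer n (x + c) = outer n (z + c)"
    and "outer n x = outer n z \<Longrightarrow> inner n (x + c) = inner n (z + c)"
    and "inner n x = inner n z \<Longrightarrow> outer n (x + c) = outer n (z + c)"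
    and "inner n x = inner n z \<Longrightarrow> inner n (x + c) = inner n (z + c)"
  by (simp_all only: outer_eq_iff[OF assms] inner_eq_iff[OF assms] mod_shift_cancel)

lemma edge_cases:
  assumes "n > 0" "{x, y} \<in> edges (gen_petersen n k)"
  obtains z where "x = outer n z" "y = outer n (z + 1)"
    | z where "x = outer n (z + 1)" "y = outer n z"
    | z where "x = outer n z" "y = inner n z"
    | z where "x = inner n z" "y = outer n z"
    | z where "x = inner n z" "y = inner n (z + int k)"
    | z where "x = inner n (z + int k)" "y = inner n z"
  using assms(2) unfolding edges_gen_petersen[OF assms(1)]
proof (elim UnE rangeE)
  fix z assume "{x, y} = {outer n z, outer n (z + 1)}"
  then show thesis using that(1,2) unfolding doubleton_eq_iff by blast
next
  fix z assume "{x, y} = {outer n z, inner n z}"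
  then show thesis using that(3,4) unfolding doubleton_eq_iff by blast
next
  fix z assume "{x, y} = {inner n z, inner n (z + int k)}"
  then show thesis using that(5,6) unfolding doubleton_eq_iff by blast
qed

lemma edges_gen_petersenI:
  assumes "n > 0"
  shows "{outer n x, outer n (x + 1)} \<in> edges (gen_petersen n k)"
    and "{outer n x, inner n x} \<in> edges (gen_petersen n k)"
    and "{inner n x, inner n (x + int k)} \<in> edges (gen_petersen n k)"
  unfolding edges_gen_petersen[OF assms] by (intro UnI1 UnI2 rangeI)+

lemma outer_neighbours:
  assumes "n > 0"
  shows "{outer n x, y} \<in> edges (gen_petersen n k) \<longleftrightarrow>
    y \<in> {outer n (x - 1), outer n (x + 1), inner n x}"
proof
  assume "{outer n x, y} \<in> edges (gen_petersen n k)"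
  with assms show "y \<in> {outer n (x - 1), outer n (x + 1), inner n x}"
  proof (cases rule: edge_cases)
    case (1 z)
    then show ?thesis using vertex_shift_cong(1)[OF assms 1(1), of 1] by simp
  next
    case (2 z)
    then show ?thesis using vertex_shift_cong(1)[OF assms 2(1), of "- 1"] by simp
  next
    case (3 z)
    then show ?thesis using vertex_shift_cong(2)[OF assms 3(1), of 0] by simp
  next
    case (4 z)
    then show ?thesis by simp
  next
    case (5 z)
    then show ?thesis by simp
  next
    case (6 z)
    then show ?thesis by simp
  qed
next
  assume "y \<in> {outer n (x - 1), outer n (x + 1), inner n x}"
  then consider "y = outer n (x - 1)" | "y = outer n (x + 1)" | "y = inner n x" by blast
  then show "{outer n x, y} \<in> edges (gen_petersen n k)"
  proof cases
    case 1
    then show ?thesis using edges_gen_petersenI(1)[OF assms, of "x - 1" k]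
      by (simp add: insert_commute)
  next
    case 2
    then show ?thesis using edges_gen_petersenI(1)[OF assms, of x k] by simp
  next
    case 3
    then show ?thesis using edges_gen_petersenI(2)[OF assms, of x k] by (simp add: insert_commute)
  qed
qed

lemma inner_neighbours:
  assumes "n > 0"
  shows "{inner n x, y} \<in> edges (gen_petersen n k) \<longleftrightarrow>
    y \<in> {inner n (x - int k), inner n (x + int k), outer n x}"
proof
  assume "{inner n x, y} \<in> edges (gen_petersen n k)"
  with assms show "y \<in> {inner n (x - int k), inner n (x + int k), outer n x}"
  proof (cases rule: edge_cases)
    case (1 z)
    then show ?thesis by simp
  next
    case (2 z)
    then show ?thesis by simp
  next
    case (3 z)
    then show ?thesis by simp
  next
    case (4 z)
    then show ?thesis using vertex_shift_cong(3)[OF assms 4(1), of 0] by simp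
  next
    case (5 z)
    then show ?thesis using vertex_shift_cong(4)[OF assms 5(1), of "int k"] by simp
  next
    case (6 z)
    then show ?thesis using vertex_shift_cong(4)[OF assms 6(1), of "- int k"] by simp
  qed
next
  assume "y \<in> {inner n (x - int k), inner n (x + int k), outer n x}"
  then consider "y = inner n (x - int k)" | "y = inner n (x + int k)" | "y = outer n x" by blast
  then show "{inner n x, y} \<in> edges (gen_petersen n k)"
  proof cases
    case 1
    then show ?thesis using edges_gen_petersenI(3)[OF assms, of "x - int k" k]
      by (simp add: insert_commute)
  next
    case 2
    then show ?thesis using edges_gen_petersenI(3)[OF assms, of x k] by simp
  next
    case 3
    then show ?thesis using edges_gen_petersenI(2)[OF assms, of x k] by (simp add: insert_commute)
  qed
qed

text \<open>This reduces domination to a covering condition on two periodic predicates, one for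
  each kind of vertex, to which counting over a period applies.\<close>

lemma dominating_set_gen_petersen_iff:
  assumes "n > 0"
  shows "dominating_set (gen_petersen n k) S \<longleftrightarrow>
    S \<subseteq> range (outer n) \<union> range (inner n) \<and>
    (\<forall>x. outer n x \<in> S \<or> outer n (x - 1) \<in> S \<or> outer n (x + 1) \<in> S \<or> inner n x \<in> S) \<and>
    (\<forall>x. inner n x \<in> S \<or> inner n (x - int k) \<in> S \<or> inner n (x + int k) \<in> S \<or> outer n x \<in> S)"
proof -
  have "(\<exists>y\<in>S. {outer n x, y} \<in> edges (gen_petersen n k)) \<longleftrightarrow>
      outer n (x - 1) \<in> S \<or> outer n (x + 1) \<in> S \<or> inner n x \<in> S" for x
    unfolding outer_neighbours[OF assms] by blast
  moreover have "(\<exists>y\<in>S. {inner n x, y} \<in> edges (gen_petersen n k)) \<longleftrightarrow>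
      inner n (x - int k) \<in> S \<or> inner n (x + int k) \<in> S \<or> outer n x \<in> S" for x
    unfolding inner_neighbours[OF assms] by blast
  ultimately show ?thesis
    unfolding dominating_set_def verts_gen_petersen[OF assms] by (simp add: ball_Un)
qed

lemma finite_dominating_set:
  assumes "n > 0" "dominating_set (gen_petersen n k) S"
  shows "finite S"
proof (rule finite_subset)
  show "S \<subseteq> V ` {..<n} \<union> U ` {..<n}"
    using assms(2) by (auto simp: dominating_set_def gen_petersen_def)
qed simp

lemma domination_number_le:
  assumes "n > 0" "dominating_set (gen_petersen n k) S"
  shows "domination_number (gen_petersen n k) \<le> card S"
  unfolding domination_number_def using assms finite_dominating_set[OF assms]
  by (intro Least_le) blast

lemma minimum_dominating_set:
  assumes "n > 0"
  obtains S where "dominating_set (gen_petersen n k) S"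
    "card S = domination_number (gen_petersen n k)"
proof -
  have dom: "dominating_set (gen_petersen n k) (verts (gen_petersen n k))"
    by (simp add: dominating_set_def)
  have "\<exists>S. dominating_set (gen_petersen n k) S \<and> finite S \<and>
      card S = domination_number (gen_petersen n k)"
    unfolding domination_number_def
    by (rule LeastI_ex) (use dom finite_dominating_set[OF assms dom] in blast)
  then show thesis using that by blast
qed

section \<open>The lower bound\<close>

text \<open>The number of solutions in one period. A sum of indicators, rather than a cardinality,
  lets the four predicates of a cover be added pointwise.\<close>

definition frequency :: "nat \<Rightarrow> (int \<Rightarrow> bool) \<Rightarrow> nat" where
  "frequency n P = (\<Sum>x\<in>{0..<int n}. of_bool (P x))"

lemma frequency_shift:
  assumes "n > 0" and periodic: "\<And>x. P (x mod int n) = P x"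
  shows "frequency n (\<lambda>x. P (x + c)) = frequency n P"
proof -
  have inj: "inj_on (\<lambda>x. (x + c) mod int n) {0..<int n}"
    by (rule inj_onI) (simp add: mod_shift_cancel)
  have "(\<lambda>x. (x + c) mod int n) ` {0..<int n} \<subseteq> {0..<int n}" using assms(1) by auto
  then have "bij_betw (\<lambda>x. (x + c) mod int n) {0..<int n} {0..<int n}"
    using inj endo_inj_surj[of "{0..<int n}"] unfolding bij_betw_def by blast
  from sum.reindex_bij_betw[OF this, of "\<lambda>x. of_bool (P x) :: nat"]
  show ?thesis by (simp add: frequency_def periodic)
qed

lemma card_eq_frequencies:
  assumes "n > 0" "S \<subseteq> range (outer n) \<union> range (inner n)"
  shows "card S = frequency n (\<lambda>x. outer n x \<in> S) + frequency n (\<lambda>x. inner n x \<in> S)"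
proof -
  let ?B = "{x \<in> {0..<int n}. outer n x \<in> S}" and ?A = "{x \<in> {0..<int n}. inner n x \<in> S}"
  have fin: "finite ?B" "finite ?A" by (rule finite_subset[of _ "{0..<int n}"]; blast)+
  have reduce: "outer n x = outer n (x mod int n)" "inner n x = inner n (x mod int n)"
    "x mod int n \<in> {0..<int n}" for x
    using assms(1) by (simp_all add: outer_def inner_def)
  have "S = outer n ` ?B \<union> inner n ` ?A"
  proof
    show "S \<subseteq> outer n ` ?B \<union> inner n ` ?A"
    proof
      fix s assume s: "s \<in> S"
      then consider x where "s = outer n x" | x where "s = inner n x" using assms(2) by blast
      then show "s \<in> outer n ` ?B \<union> inner n ` ?A"
      proof cases
        case 1
        then have "s = outer n (x mod int n)" using reduce by metis
        then show ?thesis using s reduce(3)[of x] by blast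
      next
        case 2
        then have "s = inner n (x mod int n)" using reduce by metis
        then show ?thesis using s reduce(3)[of x] by blast
      qed
    qed
  qed auto
  then have "card S = card (outer n ` ?B \<union> inner n ` ?A)" by simp
  also have "\<dots> = card (outer n ` ?B) + card (inner n ` ?A)"
    using fin by (intro card_Un_disjoint finite_imageI) auto
  also have "card (outer n ` ?B) = card ?B"
    by (intro card_image inj_onI) (use assms(1) in \<open>auto simp: outer_eq_iff\<close>)
  also have "card (inner n ` ?A) = card ?A"
    by (intro card_image inj_onI) (use assms(1) in \<open>auto simp: inner_eq_iff\<close>)
  finally show ?thesis
    by (simp add: frequency_def Int_def)
qed

text \<open>The weight counting how often \<open>x\<close> is covered is at least 1 everywhere, and by shift
  invariance its sum over a period is \<open>3 * frequency n P + frequency n Q\<close>; equality of the sums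
  forces weight 1 everywhere. The instances are the cover of the outer vertices (\<open>c = 1\<close>) and
  that of the inner vertices (\<open>c = k\<close>).\<close>

lemma frequency_cover_le:
  assumes "n > 0"
    and periodic: "\<And>x. P (x mod int n) = P x" "\<And>x. Q (x mod int n) = Q x"
    and cover: "\<And>x. P x \<or> P (x - c) \<or> P (x + c) \<or> Q x"
  shows "n \<le> 3 * frequency n P + frequency n Q"
    and "n = 3 * frequency n P + frequency n Q \<Longrightarrow>
      of_bool (P x) + of_bool (P (x - c)) + of_bool (P (x + c)) + of_bool (Q x) = (1 :: nat)"
proof -
  define w :: "int \<Rightarrow> nat" where
    "w x = of_bool (P x) + of_bool (P (x - c)) + of_bool (P (x + c)) + of_bool (Q x)" for x
  have w_ge: "1 \<le> w x" for x using cover[of x] by (auto simp: w_def)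
  have "frequency n (\<lambda>x. P (x - c)) = frequency n P"
    using frequency_shift[OF assms(1), of P "- c"] periodic by simp
  then have total: "(\<Sum>x\<in>{0..<int n}. w x) = 3 * frequency n P + frequency n Q"
    using frequency_shift[OF assms(1), of P c] periodic
    by (simp add: w_def sum.distrib frequency_def)
  have "(\<Sum>x\<in>{0..<int n}. 1 :: nat) \<le> (\<Sum>x\<in>{0..<int n}. w x)"
    by (intro sum_mono w_ge)
  then show "n \<le> 3 * frequency n P + frequency n Q" by (simp add: total)
  assume "n = 3 * frequency n P + frequency n Q"
  then have "(\<Sum>x\<in>{0..<int n}. 1 :: nat) = (\<Sum>x\<in>{0..<int n}. w x)" by (simp add: total)
  then have "1 = w (x mod int n)"
    by (rule sum_mono_inv) (use w_ge assms(1) in auto)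
  moreover have "P (x mod int n + e) = P (x + e)" for e
    by (metis periodic(1) mod_add_left_eq)
  from this[of 0] this[of c] this[of "- c"] have "w (x mod int n) = w x"
    by (simp add: w_def periodic)
  ultimately show
    "of_bool (P x) + of_bool (P (x - c)) + of_bool (P (x + c)) + of_bool (Q x) = (1 :: nat)"
    by (simp add: w_def)
qed

lemma of_bool_sum_1_exclusive:
  assumes "of_bool a + of_bool b + of_bool c + of_bool d = (1 :: nat)"
  shows "\<not> (a \<and> b)" "\<not> (a \<and> c)" "\<not> (a \<and> d)" "\<not> (b \<and> c)" "\<not> (b \<and> d)" "\<not> (c \<and> d)"
  using assms by (auto simp: of_bool_def split: if_splits)

text \<open>Here \<open>P\<close> marks the chosen outer vertices of a dominating set of \<open>2k\<close> vertices: at most one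
  row of each column is marked, and \<open>P (x + 2 * int k)\<close> says that the inner partner of the outer
  vertex \<open>x\<close> is chosen. Following the marks from \<open>x0\<close> through \<open>k\<close>
  columns back to the same column changes the row by a number of the parity of \<open>k\<close>. As the
  column has a single mark, this change only undoes the renumbering of rows by 1.\<close>

lemma perfect_pattern_odd:
  fixes k :: nat and P :: "int \<Rightarrow> bool"
  assumes periodic: "\<And>x. P (x + 4 * int k) = P x"
    and start: "P x0"
    and rows: "\<And>x. P x \<Longrightarrow> \<not> P (x + int k) \<and> \<not> P (x + 2 * int k) \<and> \<not> P (x + 3 * int k)"
    and cover: "\<And>x. P x \<or> P (x - 1) \<or> P (x + 1) \<or> P (x + 2 * int k)"
  shows "odd k"
proof
  assume "even k"
  \<comment> \<open>The outer vertices in the two rows next to the mark are covered from the left or the right.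
    Both from the left would put two marks into one column.\<close>
  have step: "P (x + 1 + int k) \<or> P (x + 1 + 3 * int k)" if "P x" for x
  proof -
    have "P (x + int k - 1) \<or> P (x + int k + 1)"
      using cover[of "x + int k"] rows[OF that] by (simp add: algebra_simps)
    moreover have "P (x + 3 * int k - 1) \<or> P (x + 3 * int k + 1)"
      using cover[of "x + 3 * int k"] rows[OF that] periodic[of "x + int k"]
      by (simp add: algebra_simps)
    moreover have "\<not> (P (x + int k - 1) \<and> P (x + 3 * int k - 1))"
      using rows[of "x + int k - 1"] by (simp add: algebra_simps)
    ultimately show ?thesis by (auto simp: algebra_simps)
  qed
  have "\<exists>j :: nat. (even j \<longleftrightarrow> even i) \<and> P (x0 + int i + int j * int k)" for i :: nat
  proof (induction i)
    case 0
    show ?case by (rule exI[of _ 0]) (simp add: start)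
  next
    case (Suc i)
    then obtain j :: nat where j: "even j \<longleftrightarrow> even i" "P (x0 + int i + int j * int k)" by blast
    from step[OF j(2)] show ?case
    proof
      assume "P (x0 + int i + int j * int k + 1 + int k)"
      then show ?thesis using j(1)
        by (intro exI[of _ "j + 1"]) (simp add: algebra_simps)
    next
      assume "P (x0 + int i + int j * int k + 1 + 3 * int k)"
      then show ?thesis using j(1)
        by (intro exI[of _ "j + 3"]) (simp add: algebra_simps)
    qed
  qed
  \<comment> \<open>For even \<open>k\<close> the mark is an odd number \<open>j + 1\<close> of rows away from the mark \<open>x0\<close> in the same
    column.\<close>
  from this[of k] obtain j :: nat where j: "even j" "P (x0 + int k + int j * int k)"
    using \<open>even k\<close> by blast
  have shift: "P (x + 4 * int k * int m) = P x" for x m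
  proof (induction m)
    case (Suc m)
    then show ?case using periodic[of "x + 4 * int k * int m"] by (simp add: algebra_simps)
  qed simp
  have "\<exists>m. j = 4 * m \<or> j = 4 * m + 2" using j(1) by presburger
  then obtain m where "j = 4 * m \<or> j = 4 * m + 2" ..
  then show False
  proof
    assume "j = 4 * m"
    then show False using j(2) shift[of "x0 + int k" m] rows[OF start] by (simp add: algebra_simps)
  next
    assume "j = 4 * m + 2"
    then show False using j(2) shift[of "x0 + 3 * int k" m] rows[OF start] by (simp add: algebra_simps)
  qed
qed

text \<open>With \<open>b\<close> outer and \<open>a\<close> inner vertices chosen, the two covers give \<open>3 b + a \<ge> 4 k\<close> and
  \<open>3 a + b \<ge> 4 k\<close>. Their sum is the lower bound; if \<open>a + b = 2 k\<close>, both are equalities and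
  \<open>a = b = k\<close>, so that the chosen vertices form a perfect pattern.\<close>

lemma card_dominating_set_ge:
  fixes k :: nat
  assumes "k \<ge> 1" and dom: "dominating_set (gen_petersen (4 * k) k) S"
  shows "2 * k \<le> card S" and "card S = 2 * k \<Longrightarrow> odd k"
proof -
  define n where "n = 4 * k"
  have n: "n > 0" using assms(1) by (simp add: n_def)
  define v u where "v x \<longleftrightarrow> outer n x \<in> S" and "u x \<longleftrightarrow> inner n x \<in> S" for x
  have periodic: "v (x mod int n) = v x" "u (x mod int n) = u x" for x
    by (simp_all add: v_def u_def outer_def inner_def)
  have S: "S \<subseteq> range (outer n) \<union> range (inner n)"
    and cover_v: "v x \<or> v (x - 1) \<or> v (x + 1) \<or> u x"
    and cover_u: "u x \<or> u (x - int k) \<or> u (x + int k) \<or> v x" for x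
    using dom[folded n_def, unfolded dominating_set_gen_petersen_iff[OF n]]
    unfolding v_def u_def by blast+
  have card_S: "card S = frequency n v + frequency n u"
    using card_eq_frequencies[OF n S] unfolding v_def[abs_def] u_def[abs_def] .
  note le_v = frequency_cover_le[OF n periodic cover_v]
    and le_u = frequency_cover_le[OF n periodic(2,1) cover_u]
  show "2 * k \<le> card S" using le_v(1) le_u(1) card_S unfolding n_def by linarith
  assume "card S = 2 * k"
  then have freq: "frequency n v = k" "frequency n u = k"
    using le_v(1) le_u(1) card_S unfolding n_def by linarith+
  then have one_u:
    "of_bool (u x) + of_bool (u (x - int k)) + of_bool (u (x + int k)) + of_bool (v x) = (1 :: nat)"
    for x
    by (intro le_u(2)) (simp add: n_def)
  have "(x + 4 * int k) mod int n = x mod int n" for x by (simp add: n_def)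
  then have period: "v (x + 4 * int k) = v x" "u (x + 4 * int k) = u x" for x
    using periodic by metis+
  have u_alone: "\<not> (u x \<and> u (x + int k))" "\<not> (u x \<and> u (x + 2 * int k))"
    "\<not> (u x \<and> u (x + 3 * int k))" for x
  proof -
    show "\<not> (u x \<and> u (x + int k))" by (rule of_bool_sum_1_exclusive(2)[OF one_u])
    have "x + int k - int k = x" "x + int k + int k = x + 2 * int k" by simp_all
    then show "\<not> (u x \<and> u (x + 2 * int k))"
      using of_bool_sum_1_exclusive(4)[OF one_u[of "x + int k"]] by metis
    have "x - int k + 4 * int k = x + 3 * int k" by simp
    then show "\<not> (u x \<and> u (x + 3 * int k))"
      using of_bool_sum_1_exclusive(1)[OF one_u[of x]] period(2)[of "x - int k"] by metis
  qed
  \<comment> \<open>The inner vertex opposite to a chosen one has no chosen inner neighbour and is not chosen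
    itself, so it is dominated by its outer partner.\<close>
  have u_imp_v: "v (x + 2 * int k)" if "u x" for x
  proof -
    have "x + 2 * int k - int k = x + int k" "x + 2 * int k + int k = x + 3 * int k" by simp_all
    then show ?thesis using cover_u[of "x + 2 * int k"] u_alone[of x] that by metis
  qed
  \<comment> \<open>There are \<open>k\<close> vertices of either kind, so the implication is an equivalence.\<close>
  have v_eq_u: "v x \<longleftrightarrow> u (x + 2 * int k)" for x
  proof -
    have "(\<Sum>x\<in>{0..<int n}. of_bool (u (x + 2 * int k)) :: nat) = (\<Sum>x\<in>{0..<int n}. of_bool (v x))"
      using frequency_shift[OF n, of u "2 * int k"] periodic freq by (simp add: frequency_def)
    then have "of_bool (u (x mod int n + 2 * int k)) = (of_bool (v (x mod int n)) :: nat)"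
    proof (rule sum_mono_inv)
      fix y
      have "y + 2 * int k + 2 * int k = y + 4 * int k" by simp
      then have "u (y + 2 * int k) \<longrightarrow> v y"
        using u_imp_v[of "y + 2 * int k"] period(1)[of y] by metis
      then show "of_bool (u (y + 2 * int k)) \<le> (of_bool (v y) :: nat)" by simp
    qed (use n in auto)
    moreover have "u (x mod int n + 2 * int k) = u (x + 2 * int k)"
      by (metis periodic(2) mod_add_left_eq)
    ultimately show ?thesis using periodic(1)[of x] unfolding of_bool_eq_iff by metis
  qed
  obtain x0 where "v x0"
    using cover_v[of 0] cover_u u_imp_v by blast
  then show "odd k"
  proof (rule perfect_pattern_odd[rotated])
    show "v (x + 4 * int k) = v x" for x by (rule period)
    show "\<not> v (x + int k) \<and> \<not> v (x + 2 * int k) \<and> \<not> v (x + 3 * int k)" if "v x" for x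
    proof -
      have "x + int k + 2 * int k = x + 2 * int k + int k"
        "x + 3 * int k + 2 * int k = x + 2 * int k + 3 * int k" by simp_all
      then show ?thesis using that u_alone[of "x + 2 * int k"] v_eq_u by metis
    qed
    show "v x \<or> v (x - 1) \<or> v (x + 1) \<or> v (x + 2 * int k)" for x
      using cover_v[of x] u_imp_v[of x] by blast
  qed
qed

section \<open>Dominating sets attaining the bounds\<close>

text \<open>A set described by residues modulo 4 is well defined since 4 divides the number of indices, and
  for odd \<open>k\<close> the inner vertices with residue 1 or 3 have a neighbour with residue 2.\<close>

lemma domination_number_le_odd:
  fixes k :: nat
  assumes "odd k"
  shows "domination_number (gen_petersen (4 * k) k) \<le> 2 * k"
proof -
  define n where "n = 4 * k"
  have n: "n > 0" using assms by (auto simp: n_def intro: odd_pos)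
  define S where "S = (\<lambda>i. outer n (4 * int i)) ` {..<k} \<union> (\<lambda>i. inner n (4 * int i + 2)) ` {..<k}"
  have residue: "\<exists>i<k. (4 * int i + r) mod int n = x mod int n" if "4 dvd x - r" for x r
  proof -
    obtain q where q: "x = 4 * q + r" using \<open>4 dvd x - r\<close> by (auto simp: dvd_def algebra_simps)
    have k: "int k > 0" using n by (simp add: n_def)
    have "int n dvd (4 * int (nat (q mod int k)) + r) - x"
    proof -
      have "(4 * int (nat (q mod int k)) + r) - x = 4 * (q mod int k - q)"
        using k q by simp
      also have "\<dots> = int n * (- (q div int k))"
        by (simp add: n_def minus_div_mult_eq_mod[symmetric])
      finally have "(4 * int (nat (q mod int k)) + r) - x = int n * (- (q div int k))" .
      then show ?thesis by simp
    qed
    then show ?thesis using k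
      by (intro exI[of _ "nat (q mod int k)"]) (auto simp: mod_eq_dvd_iff nat_less_iff)
  qed
  have outer_S: "outer n x \<in> S" if "4 dvd x" for x
  proof -
    obtain i where i: "i < k" "(4 * int i) mod int n = x mod int n"
      using residue[of x 0] \<open>4 dvd _\<close> by auto
    then have "outer n x = outer n (4 * int i)" by (simp only: outer_eq_iff[OF n])
    then show ?thesis using i(1) unfolding S_def by blast
  qed
  have inner_S: "inner n x \<in> S" if "4 dvd x - 2" for x
  proof -
    obtain i where i: "i < k" "(4 * int i + 2) mod int n = x mod int n"
      using residue[of x 2] \<open>4 dvd _\<close> by auto
    then have "inner n x = inner n (4 * int i + 2)" by (simp only: inner_eq_iff[OF n])
    then show ?thesis using i(1) unfolding S_def by blast
  qed
  have "dominating_set (gen_petersen n k) S"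
    unfolding dominating_set_gen_petersen_iff[OF n]
  proof (intro conjI allI)
    show "S \<subseteq> range (outer n) \<union> range (inner n)" by (auto simp: S_def)
    fix x :: int
    have "4 dvd x \<or> 4 dvd x - 1 \<or> 4 dvd x + 1 \<or> 4 dvd x - 2" by presburger
    then show "outer n x \<in> S \<or> outer n (x - 1) \<in> S \<or> outer n (x + 1) \<in> S \<or> inner n x \<in> S"
      using outer_S inner_S by blast
    have "odd (int k)" using assms by simp
    then have "4 dvd x - 2 \<or> 4 dvd x - int k - 2 \<or> 4 dvd x + int k - 2 \<or> 4 dvd x" by presburger
    then show "inner n x \<in> S \<or> inner n (x - int k) \<in> S \<or> inner n (x + int k) \<in> S \<or> outer n x \<in> S"
      using outer_S inner_S by blast
  qed
  then have "domination_number (gen_petersen n k) \<le> card S" by (rule domination_number_le[OF n])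
  also have "card S \<le> k + k"
    unfolding S_def by (rule order.trans[OF card_Un_le add_mono]; rule card_image_le[THEN order.trans]) auto
  finally show ?thesis by (simp add: n_def)
qed

text \<open>The staircase chooses in column \<open>c\<close> the outer vertex of row \<open>d * c\<close> and the inner vertex two
  rows away, with \<open>d = 1\<close> or \<open>d = - 1\<close>. An outer vertex in an adjacent row is dominated by the
  next or the previous column, except in row \<open>d * k\<close> of the last column and row \<open>- d\<close> of the
  first. The former precedes row \<open>d * k + 1\<close> of the first column. For \<open>d * k + 1\<close> congruent
  to \<open>- d\<close> modulo 4 the two exceptions are therefore adjacent, and adding the latter settles
  both.\<close>

lemma domination_number_le_even:
  fixes k :: nat
  assumes "k \<ge> 1" "even k"
  shows "domination_number (gen_petersen (4 * k) k) \<le> 2 * k + 1"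
proof -
  define n where "n = 4 * k"
  have n: "n > 0" using assms by (simp add: n_def)
  \<comment> \<open>\<open>d = 1\<close> if \<open>k\<close> is 2 modulo 4, and \<open>d = - 1\<close> if \<open>k\<close> is 0 modulo 4.\<close>
  obtain d :: int where d: "d = 1 \<or> d = - 1" "4 dvd d * int k + 1 + d"
  proof -
    have "4 dvd int k \<or> 4 dvd int k + 2" using assms(2) by presburger
    then show thesis using that[of 1] that[of "- 1"] by (auto simp: add.commute)
  qed
  define S where "S = (\<lambda>c. outer n (int c + d * int c * int k)) ` {..<k} \<union>
      (\<lambda>c. inner n (int c + (d * int c + 2) * int k)) ` {..<k} \<union> {outer n (- d * int k)}"
  have row: "(c + i * int k) mod int n = (c + j * int k) mod int n" if "4 dvd i - j" for c i j :: int
  proof -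
    have "int n dvd (i - j) * int k" using that by (simp add: n_def)
    then show ?thesis by (simp add: mod_eq_dvd_iff algebra_simps)
  qed
  have outer_S: "outer n (c + j * int k) \<in> S" if "0 \<le> c" "c < int k" "4 dvd j - d * c" for c j
  proof -
    have "outer n (c + j * int k) = outer n (int (nat c) + d * int (nat c) * int k)"
      using row[OF that(3)] n that(1) by (simp add: outer_eq_iff)
    moreover have "nat c < k" using that by simp
    ultimately show ?thesis unfolding S_def by blast
  qed
  have inner_S: "inner n (c + j * int k) \<in> S" if "0 \<le> c" "c < int k" "4 dvd j - (d * c + 2)" for c j
  proof -
    have "inner n (c + j * int k) = inner n (int (nat c) + (d * int (nat c) + 2) * int k)"
      using row[OF that(3)] n that(1) by (simp add: inner_eq_iff)
    moreover have "nat c < k" using that by simp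
    ultimately show ?thesis unfolding S_def by blast
  qed
  have extra_S: "outer n (j * int k) \<in> S" if "4 dvd j + d" for j
    using row[of j "- d" 0] that n by (simp add: S_def outer_eq_iff)
  have "dominating_set (gen_petersen n k) S"
    unfolding dominating_set_gen_petersen_iff[OF n]
  proof (intro conjI allI)
    show "S \<subseteq> range (outer n) \<union> range (inner n)" by (auto simp: S_def)
    fix x :: int
    define c j where "c = x mod int k" and "j = x div int k"
    have x: "x = c + j * int k" and c: "0 \<le> c" "c < int k"
      using assms(1) by (simp_all add: c_def j_def)
    \<comment> \<open>The row of \<open>x\<close> relative to the chosen outer vertex of its column.\<close>
    define t where "t = j - d * c"
    consider "4 dvd t" | "4 dvd t - 2" | "4 dvd t - d" | "4 dvd t + d"
    proof -
      have "4 dvd t \<or> 4 dvd t - 2 \<or> 4 dvd t - 1 \<or> 4 dvd t + 1" by presburger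
      then show thesis using that d(1) by auto
    qed
    then show "outer n x \<in> S \<or> outer n (x - 1) \<in> S \<or> outer n (x + 1) \<in> S \<or> inner n x \<in> S"
    proof cases
      case 1
      then show ?thesis using outer_S[OF c] by (simp add: x t_def)
    next
      case 2
      then show ?thesis using inner_S[OF c] by (simp add: x t_def algebra_simps)
    next
      case 3
      then have j: "4 dvd j - d * (c + 1)" by (simp add: t_def algebra_simps)
      show ?thesis
      proof (cases "c + 1 < int k")
        case True
        then show ?thesis using outer_S[OF _ True j] c(1) by (simp add: x algebra_simps)
      next
        case False
        then have k: "int k = c + 1" using c by simp
        have "4 dvd (j - d * (c + 1)) + (d * int k + 1 + d)" using j d(2) by (rule dvd_add)
        then have "4 dvd (j + 1) + d" by (simp add: k algebra_simps)
        then show ?thesis using extra_S[of "j + 1"] k by (simp add: x algebra_simps)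
      qed
    next
      case 4
      then have j: "4 dvd j - d * (c - 1)" by (simp add: t_def algebra_simps)
      show ?thesis
      proof (cases "c = 0")
        case True
        then show ?thesis using extra_S[of j] j by (simp add: x)
      next
        case False
        then show ?thesis using outer_S[OF _ _ j] c by (simp add: x algebra_simps)
      qed
    qed
    consider "4 dvd t" | "4 dvd t - 2" | "4 dvd (t + 1) - 2" | "4 dvd (t - 1) - 2"
    proof -
      have "4 dvd t \<or> 4 dvd t - 2 \<or> 4 dvd (t + 1) - 2 \<or> 4 dvd (t - 1) - 2" by presburger
      then show thesis using that by blast
    qed
    then show "inner n x \<in> S \<or> inner n (x - int k) \<in> S \<or> inner n (x + int k) \<in> S \<or> outer n x \<in> S"
    proof cases
      case 1
      then show ?thesis using outer_S[OF c] by (simp add: x t_def)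
    next
      case 2
      then show ?thesis using inner_S[OF c] by (simp add: x t_def algebra_simps)
    next
      case 3
      then show ?thesis using inner_S[OF c, of "j + 1"] by (simp add: x t_def algebra_simps)
    next
      case 4
      then show ?thesis using inner_S[OF c, of "j - 1"] by (simp add: x t_def algebra_simps)
    qed
  qed
  then have "domination_number (gen_petersen n k) \<le> card S" by (rule domination_number_le[OF n])
  also have "card S \<le> k + k + 1"
    unfolding S_def
    by (intro order.trans[OF card_Un_le] add_mono order.trans[OF card_image_le]) auto
  finally show ?thesis by (simp add: n_def)
qed

theorem theorem2p2:
  fixes k :: nat
  assumes "k \<ge> 1"
  shows "domination_number (gen_petersen (4 * k) k) =
    (if k mod 2 = 1 then 2 * k else 2 * k + 1)"
proof -
  have "4 * k > 0" using assms by simp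
  then obtain S where S: "dominating_set (gen_petersen (4 * k) k) S"
    "card S = domination_number (gen_petersen (4 * k) k)"
    by (rule minimum_dominating_set)
  note lower = card_dominating_set_ge[OF assms S(1)]
  show ?thesis
  proof (cases "odd k")
    case True
    then show ?thesis using domination_number_le_odd[OF True] lower(1) S(2)
      by (simp add: odd_iff_mod_2_eq_one)
  next
    case False
    then have "card S \<noteq> 2 * k" using lower(2) by blast
    then show ?thesis using domination_number_le_even[OF assms] False lower(1) S(2)
      by (simp add: even_iff_mod_2_eq_zero)
  qed
qed

end
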